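(* Let $e \ge 2$, let $2 \le g_1 < \ldots < g_e$ be integers with $\gcd(g_1,\ldots,g_e)=1$, let $S=\langle g_1,\ldots,g_e \rangle$, and suppose that $\{g_1,\ldots,g_e\}$ is the minimal generating system of $S$. Let $F=\max(\mathbb{Z}\setminus S)$ and $n=|S\cap[0,F]|$. Then $$g_1 \le (e-1)n+1.$$
   Context: $\mathbb{N}$ denotes the set of non-negative integers. For $g_1,\ldots,g_e\in\mathbb{N}$ with $\gcd(g_1,\ldots,g_e)=1$, $\langle g_1,\ldots,g_e\rangle=\{a_1g_1+\ldots+a_eg_e \mid a_i\in\mathbb{N}\}$; it is a submonoid of $(\mathbb{N},+)$ with finite complement in $\mathbb{N}$, called a numerical semigroup. Every numerical semigroup has a unique minimal generating system (a generating set no proper subset of which generates $S$), and its cardinality $e$ is the embedding dimension of $S$. $F$ is the Frobenius number of $S$, and $n$ is the number of elements of $S$ less than $F$. *)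

theory Defs
  imports Complex_Main
begin

definition generated_submonoid :: "nat set \<Rightarrow> nat set" where
  "generated_submonoid A = {\<Sum>x\<in>X. c x * x | X c. finite X \<and> X \<subseteq> A}"

text \<open>For a finite set of generators these are exactly the combinations of all generators.\<close>

lemma generated_submonoid_finite:
  assumes "finite A"
  shows "generated_submonoid A = {\<Sum>x\<in>A. c x * x | c. True}"
proof (intro equalityI subsetI)
  fix s assume "s \<in> generated_submonoid A"
  then obtain X c where X: "X \<subseteq> A" and s: "s = (\<Sum>x\<in>X. c x * x)"
    unfolding generated_submonoid_def by blast
  have "s = (\<Sum>x\<in>A. (if x \<in> X then c x else 0) * x)"
    unfolding s using assms X by (intro sum.mono_neutral_cong_left) auto
  then show "s \<in> {\<Sum>x\<in>A. c x * x | c. True}"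
    by (intro CollectI exI[of _ "\<lambda>x. if x \<in> X then c x else 0"]) simp
next
  fix s assume "s \<in> {\<Sum>x\<in>A. c x * x | c. True}"
  then show "s \<in> generated_submonoid A"
    unfolding generated_submonoid_def using assms by blast
qed

definition minimal_generating_system :: "nat set \<Rightarrow> nat set \<Rightarrow> bool" where
  "minimal_generating_system A S \<longleftrightarrow>
     generated_submonoid A = S \<and> (\<forall>B. B \<subset> A \<longrightarrow> generated_submonoid B \<noteq> S)"

text \<open>The maximum is taken in the integers; it exists for every numerical semigroup (it is
  \<open>-1\<close> if \<open>S\<close> is all of the natural numbers). \<open>Max\<close> is not applicable, since the complement
  is infinite.\<close>

definition frobenius_number :: "nat set \<Rightarrow> int" where
  "frobenius_number S = (GREATEST z. z \<notin> int ` S)"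

end

theory Submission
  imports Defs
begin

text \<open>
  Let \<open>m = g\<^sub>1\<close>. The elements of the Apery set of \<open>S\<close> with respect to \<open>m\<close>, that is, the least
  elements of \<open>S\<close> in the residue classes modulo \<open>m\<close>, are used to count \<open>m\<close>. Let \<open>w\<close> be the
  least element of \<open>S\<close> in a nonzero residue class. It is a nonempty sum of generators, so
  \<open>w = a + s\<close> for a generator \<open>a\<close> and some \<open>s \<in> S\<close>. Minimality of \<open>w\<close> says that \<open>w - m\<close> is not
  in \<open>S\<close>. This has two consequences: \<open>a \<noteq> m\<close>, which leaves \<open>e - 1\<close> choices for \<open>a\<close>; and
  \<open>w - m \<le> F\<close>, hence \<open>s = w - a < w - m \<le> F\<close>, which leaves at most \<open>n\<close> choices for \<open>s\<close>.
  Since \<open>(a, s)\<close> determines \<open>w\<close>, and with it the residue class, there are at most \<open>(e - 1) n\<close>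
  nonzero residue classes, that is, \<open>m - 1 \<le> (e - 1) n\<close>.

  That every residue class meets \<open>S\<close>, and that \<open>F\<close> bounds the gaps of \<open>S\<close>, both rest on the
  finiteness of the complement of \<open>S\<close> (\<open>cofinite_if_Gcd_eq_1\<close>).
\<close>

text \<open>
  Euclidean division works on differences of elements of \<open>S\<close>: the least positive difference
  divides every element of \<open>S\<close> and so equals \<open>1\<close>. Two consecutive elements \<open>y\<close> and \<open>y + 1\<close> of
  \<open>S\<close> then generate all numbers from \<open>y\<^sup>2\<close> on.
\<close>

lemma cofinite_if_Gcd_eq_1:
  fixes S :: "nat set"
  assumes zero: "0 \<in> S"
    and add: "\<And>x y. x \<in> S \<Longrightarrow> y \<in> S \<Longrightarrow> x + y \<in> S"
    and Gcd: "Gcd S = 1"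
  shows "\<exists>N. \<forall>z\<ge>N. z \<in> S"
proof -
  have mult: "k * x \<in> S" if "x \<in> S" for k x
    by (induction k) (use that zero add in auto)
  define P where "P d \<longleftrightarrow> 0 < d \<and> (\<exists>y\<in>S. y + d \<in> S)" for d
  have "\<exists>x\<in>S. 0 < x"
  proof (rule ccontr)
    assume "\<not> ?thesis"
    then have "S \<subseteq> {0}" by auto
    with Gcd show False using Gcd_0_iff[of S] by simp
  qed
  then have "\<exists>d. P d"
    using zero by (auto simp: P_def intro!: bexI[of _ 0])
  define d where "d = (LEAST d. P d)"
  have "P d" unfolding d_def using \<open>\<exists>d. P d\<close> by (rule LeastI_ex)
  then obtain y where y: "y \<in> S" "y + d \<in> S" and "0 < d" by (auto simp: P_def)
  have "d dvd x" if "x \<in> S" for x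
  proof (rule ccontr)
    assume "\<not> d dvd x"
    then have "0 < x mod d" by (simp add: mod_greater_zero_iff_not_dvd)
    \<comment> \<open>The remainder of \<open>x\<close> is a difference of elements of \<open>S\<close> as well.\<close>
    moreover have "x div d * (y + d) + x mod d = x + x div d * y"
      using div_mult_mod_eq[of x d] by (simp add: algebra_simps)
    then have "x div d * (y + d) + x mod d \<in> S" using add that mult y by simp
    ultimately have "P (x mod d)" using mult[OF y(2)] by (auto simp: P_def)
    then have "d \<le> x mod d" unfolding d_def by (rule Least_le)
    then show False using mod_less_divisor[OF \<open>0 < d\<close>, of x] by linarith
  qed
  then have "d dvd Gcd S" by (rule Gcd_greatest)
  with Gcd have "d = 1" by simp
  have "z \<in> S" if "y * y \<le> z" for z
  proof (cases "y = 0")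
    case True
    then show ?thesis using mult[OF y(2), of z] \<open>d = 1\<close> by simp
  next
    case False
    have "y \<le> z div y" using that False by (simp add: less_eq_div_iff_mult_less_eq)
    moreover have "z mod y < y" using False by simp
    ultimately have "(z div y - z mod y) * y + z mod y * (y + 1) = z div y * y + z mod y"
      by (simp add: algebra_simps diff_mult_distrib)
    also have "\<dots> = z" by simp
    finally show ?thesis using add[OF mult mult, OF y] \<open>d = 1\<close> by metis
  qed
  then show ?thesis by blast
qed

lemma gap_le_frobenius_number:
  assumes "\<forall>z\<ge>N. z \<in> S" and "z \<notin> int ` S"
  shows "z \<le> frobenius_number S"
proof -
  have bound: "x < int N" if "x \<notin> int ` S" for x
  proof (rule ccontr)
    assume "\<not> ?thesis"
    then have "x = int (nat x)" "N \<le> nat x" by auto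
    with assms(1) that show False by blast
  qed
  define G where "G = {x \<in> {z..int N}. x \<notin> int ` S}"
  have "finite G" by (rule finite_subset[of _ "{z..int N}"]) (auto simp: G_def)
  moreover have "z \<in> G" using assms(2) bound by (auto simp: G_def less_imp_le)
  ultimately have Max: "Max G \<in> G" "z \<le> Max G" by (auto intro: Max_in)
  have "x \<le> Max G" if "x \<notin> int ` S" for x
  proof (cases "z \<le> x")
    case True
    then have "x \<in> G" using that bound[OF that] by (simp add: G_def)
    then show ?thesis using \<open>finite G\<close> by simp
  qed (use Max in auto)
  then have "frobenius_number S = Max G"
    unfolding frobenius_number_def using Max(1)
    by (intro Greatest_equality) (auto simp: G_def)
  with Max show ?thesis by simp
qed

lemma zero_in_generated_submonoid: "0 \<in> generated_submonoid A"
  unfolding generated_submonoid_def by (auto intro!: exI[of _ "{}"])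

lemma subset_generated_submonoid: "A \<subseteq> generated_submonoid A"
proof
  fix a assume "a \<in> A"
  then show "a \<in> generated_submonoid A"
    unfolding generated_submonoid_def
    by (intro CollectI exI[of _ "{a}"] exI[of _ "\<lambda>_. 1"]) simp
qed

lemma add_in_generated_submonoid:
  assumes "finite A" "x \<in> generated_submonoid A" "y \<in> generated_submonoid A"
  shows "x + y \<in> generated_submonoid A"
proof -
  obtain c d where "x = (\<Sum>a\<in>A. c a * a)" "y = (\<Sum>a\<in>A. d a * a)"
    using assms by (auto simp: generated_submonoid_finite)
  then have "x + y = (\<Sum>a\<in>A. (c a + d a) * a)"
    by (simp add: sum.distrib algebra_simps)
  then show ?thesis
    unfolding generated_submonoid_finite[OF assms(1)]
    by (intro CollectI exI[of _ "\<lambda>a. c a + d a"]) simp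
qed

lemma generated_submonoid_nonzero_split:
  assumes "finite A" "w \<in> generated_submonoid A" "w \<noteq> 0"
  obtains a s where "a \<in> A" "s \<in> generated_submonoid A" "w = a + s"
proof -
  obtain c where c: "w = (\<Sum>a\<in>A. c a * a)"
    using assms by (auto simp: generated_submonoid_finite)
  with assms obtain a where a: "a \<in> A" "c a \<noteq> 0" by (auto simp: sum.neutral)
  define s where "s = (\<Sum>x\<in>A. (c(a := c a - 1)) x * x)"
  have "w = c a * a + (\<Sum>x\<in>A - {a}. c x * x)"
    unfolding c using assms(1) a(1) by (rule sum.remove)
  moreover have "s = (c a - 1) * a + (\<Sum>x\<in>A - {a}. c x * x)"
    unfolding s_def using assms(1) a(1) by (simp add: sum.remove)
  ultimately have "w = a + s" using a(2) by (cases "c a") simp_all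
  moreover have "s \<in> generated_submonoid A"
    unfolding generated_submonoid_finite[OF assms(1)] s_def by blast
  ultimately show thesis using that a(1) by blast
qed

lemma Gcd_generated_submonoid:
  assumes "Gcd A = 1"
  shows "Gcd (generated_submonoid A) = 1"
proof -
  have "Gcd (generated_submonoid A) dvd Gcd A"
    using subset_generated_submonoid by (blast intro: Gcd_greatest Gcd_dvd)
  with assms show ?thesis by simp
qed

text \<open>
  Every nonzero residue class modulo \<open>m\<close> is sent to the two summands of its Apery element: a
  generator other than \<open>m\<close> and an element of \<open>S\<close> below the Frobenius number.
\<close>

lemma least_generator_bound:
  assumes "finite A" "Gcd A = 1" "m \<in> A" "0 < m" and least: "\<And>a. a \<in> A \<Longrightarrow> m \<le> a"
  defines "S \<equiv> generated_submonoid A"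
  shows "m \<le> (card A - 1) * card (int ` S \<inter> {0..frobenius_number S}) + 1"
proof -
  define T where "T = int ` S \<inter> {0..frobenius_number S}"
  note add = add_in_generated_submonoid[OF \<open>finite A\<close>, folded S_def]
  obtain N where N: "\<forall>z\<ge>N. z \<in> S"
    using cofinite_if_Gcd_eq_1[of S] add zero_in_generated_submonoid
      Gcd_generated_submonoid[OF \<open>Gcd A = 1\<close>] unfolding S_def by blast
  have split: "\<exists>a s. a \<in> A - {m} \<and> int s \<in> T \<and> (a + s) mod m = r" if r: "r \<in> {1..<m}" for r
  proof -
    define P where "P w \<longleftrightarrow> w \<in> S \<and> w mod m = r" for w
    define w where "w = (LEAST w. P w)"
    have "P (N * m + r)"
      using N r \<open>0 < m\<close> by (auto simp: P_def trans_le_add1)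
    then have "P w" unfolding w_def by (rule LeastI)
    then have "w \<noteq> 0" using r by (intro notI) (auto simp: P_def)
    with \<open>P w\<close> obtain a s where as: "a \<in> A" "s \<in> S" "w = a + s"
      using generated_submonoid_nonzero_split[OF \<open>finite A\<close>] unfolding P_def S_def by metis
    have gap: "v \<notin> S" if "w = m + v" for v
    proof
      assume "v \<in> S"
      with that \<open>P w\<close> have "P v" by (simp add: P_def)
      then have "w \<le> v" unfolding w_def by (rule Least_le)
      with that \<open>0 < m\<close> show False by simp
    qed
    have "a \<noteq> m" using gap as by blast
    have "int w - int m \<notin> int ` S" using gap by force
    then have "int w - int m \<le> frobenius_number S" by (rule gap_le_frobenius_number[OF N])
    then have "int s \<in> T" using as least[OF as(1)] by (auto simp: T_def)
    then show ?thesis using as \<open>a \<noteq> m\<close> \<open>P w\<close> by (auto simp: P_def)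
  qed
  obtain f h where fh: "\<And>r. r \<in> {1..<m} \<Longrightarrow>
      f r \<in> A - {m} \<and> int (h r) \<in> T \<and> (f r + h r) mod m = r"
    using split by metis
  have "inj_on (\<lambda>r. (f r, int (h r))) {1..<m}"
    by (rule inj_onI) (metis fh of_nat_eq_iff prod.inject)
  moreover have "(\<lambda>r. (f r, int (h r))) ` {1..<m} \<subseteq> (A - {m}) \<times> T"
    using fh by blast
  moreover have "finite ((A - {m}) \<times> T)" using \<open>finite A\<close> by (simp add: T_def)
  ultimately have "card {1..<m} \<le> card ((A - {m}) \<times> T)" by (rule card_inj_on_le)
  then have "m - 1 \<le> (card A - 1) * card T"
    using \<open>m \<in> A\<close> by (simp add: card_cartesian_product)
  then show ?thesis unfolding T_def by simp
qed

theorem theorem2: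
  fixes e n :: nat and g :: "nat \<Rightarrow> nat" and S :: "nat set" and F :: int
  assumes "e \<ge> 2"
    and "2 \<le> g 1"
    and "strict_mono_on {1..e} g"
    and "Gcd (g ` {1..e}) = 1"
    and "S = generated_submonoid (g ` {1..e})"
    and "minimal_generating_system (g ` {1..e}) S"
    and "F = frobenius_number S"
    and "n = card (int ` S \<inter> {0..F})"
  shows "g 1 \<le> (e - 1) * n + 1"
proof -
  have "g 1 \<le> a" if "a \<in> g ` {1..e}" for a
    using that strict_mono_on_leD[OF assms(3)] by auto
  moreover have "card (g ` {1..e}) = e"
    using strict_mono_on_imp_inj_on[OF assms(3)] by (simp add: card_image)
  ultimately show ?thesis
    using least_generator_bound[of "g ` {1..e}" "g 1"] assms by simp
qed

end
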